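(* Let $N$ be an odd positive integer with $\sigma^*(\sigma^*(N))=2N$ and $N\neq 9,165$, and write $\sigma^*(N)=2^{f_1}q^{f_2}$ with $q$ an odd prime and $f_1,f_2\ge1$. Then $q\neq 5$.
   Context: $\sigma^*(n)$ is the sum of the unitary divisors of $n$, i.e. divisors $d$ of $n$ with $\gcd(d,n/d)=1$. For odd $N$ with $\sigma^*(\sigma^*(N))=2N$, $\sigma^*(N)$ is always of the form $2^{f_1}q^{f_2}$ with $q$ an odd prime. *)

theory Defs
  imports "HOL-Number_Theory.Number_Theory"
begin

definition unitary_divisor :: "nat \<Rightarrow> nat \<Rightarrow> bool" where
  "unitary_divisor d n \<longleftrightarrow> d dvd n \<and> coprime d (n div d)"

definition usigma :: "nat \<Rightarrow> nat" where
  "usigma n = (\<Sum>d | unitary_divisor d n. d)"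

end

theory Submission
  imports Defs
begin

text \<open>
  Let \<open>q = 5\<close>. Since \<open>\<sigma>\<^sup>*\<close> is multiplicative, \<open>2 N = (2 ^ f1 + 1) (5 ^ f2 + 1)\<close>, and every
  \<open>P + 1\<close>, with \<open>P\<close> running over the maximal prime powers dividing \<open>N\<close>, has the form \<open>2 ^ a 5 ^ b\<close>.
  On the one hand, \<open>N / \<sigma>\<^sup>*(N) = (1 + 2 ^ -f1) (1 + 5 ^ -f2) / 2\<close>; on the other hand, this quotient is the
  product of the numbers \<open>1 - 1 / (P + 1)\<close> and hence at least \<open>1 - \<Sum> 1 / (P + 1)\<close>. A prime
  dividing \<open>2 ^ f1 + 1\<close> or \<open>5 ^ f2 + 1\<close> divides \<open>x\<^sup>2 + 1\<close>, \<open>x\<^sup>2 + 2\<close> or \<open>x\<^sup>2 + 5\<close> for some \<open>x\<close>,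
  which restricts its residues modulo 8 and 20 and so leaves three geometric families for
  \<open>P + 1\<close>: \<open>10 \<cdot> 5 ^ b\<close>, \<open>4 \<cdot> 5 ^ b\<close> and \<open>8 \<cdot> 4 ^ k\<close>. The sum of their reciprocals is too small
  unless \<open>f1\<close> or \<open>f2\<close> is very small, where \<open>N = 9\<close> is the only survivor.
\<close>

section \<open>Unitary divisors and the multiplicativity of \<open>usigma\<close>\<close>

lemma unitary_divisor_iff:
  assumes "n > 0"
  shows "unitary_divisor d n \<longleftrightarrow> (\<exists>k. n = d * k \<and> coprime d k)"
  using assms unfolding unitary_divisor_def by (auto simp: dvd_def)

lemma unitary_divisors_mult:
  assumes "coprime m n" "m > 0" "n > 0"
  shows "{d. unitary_divisor d (m * n)} =
    (\<lambda>(x, y). x * y) ` ({d. unitary_divisor d m} \<times> {d. unitary_divisor d n})"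
proof (intro equalityI subsetI)
  fix d assume "d \<in> {d. unitary_divisor d (m * n)}"
  then obtain k where k: "m * n = d * k" "coprime d k"
    using assms by (auto simp: unitary_divisor_iff)
  \<comment> \<open>A divisor of \<open>m * n\<close> splits into divisors of \<open>m\<close> and
    \<open>n\<close>; its cofactor \<open>k\<close> then splits as \<open>u * v\<close>, so
    coprimality passes to both parts.\<close>
  obtain x y where xy: "d = x * y" "x dvd m" "y dvd n"
    using division_decomp[of d m n] k by (metis dvd_triv_left)
  obtain u v where uv: "m = x * u" "n = y * v" using xy by (elim dvdE)
  have "x * y * k = m * n" using k(1) xy(1) by simp
  also have "\<dots> = x * y * (u * v)" unfolding uv by (simp add: mult_ac)
  finally have "x * y * k = x * y * (u * v)" .
  moreover have "x * y > 0" using uv assms by auto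
  ultimately have "k = u * v" by (metis mult_cancel1 less_not_refl)
  then have "coprime x u" "coprime y v" using k(2) xy(1) by auto
  then have "unitary_divisor x m" "unitary_divisor y n"
    using uv assms by (auto simp: unitary_divisor_iff)
  then show "d \<in> (\<lambda>(x, y). x * y) ` ({d. unitary_divisor d m} \<times> {d. unitary_divisor d n})"
    using xy(1) by auto
next
  fix d assume "d \<in> (\<lambda>(x, y). x * y) ` ({d. unitary_divisor d m} \<times> {d. unitary_divisor d n})"
  then obtain x y where xy: "d = x * y" "unitary_divisor x m" "unitary_divisor y n" by auto
  then obtain u v where uv: "m = x * u" "coprime x u" "n = y * v" "coprime y v"
    using assms by (auto simp: unitary_divisor_iff)
  have "m * n = d * (u * v)" using uv xy(1) by simp
  moreover have "coprime d (u * v)" using uv xy(1) assms(1) by (auto simp: coprime_commute)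
  moreover have "m * n > 0" using assms by simp
  ultimately show "d \<in> {d. unitary_divisor d (m * n)}"
    unfolding mem_Collect_eq using unitary_divisor_iff by blast
qed

lemma usigma_mult:
  assumes "coprime m n" "m > 0" "n > 0"
  shows "usigma (m * n) = usigma m * usigma n"
proof -
  let ?U = "\<lambda>n. {d. unitary_divisor d n}"
  have inj: "inj_on (\<lambda>(x, y). x * y) (?U m \<times> ?U n)"
  proof (rule inj_onI, clarsimp)
    fix x y x' y'
    assume *: "unitary_divisor x m" "unitary_divisor y n" "unitary_divisor x' m"
      "unitary_divisor y' n" "x * y = x' * y'"
    have dvd: "x dvd m" "x' dvd m" "y dvd n" "y' dvd n"
      using * by (auto simp: unitary_divisor_def)
    have "x > 0" using dvd assms by (auto intro: dvd_pos_nat)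
    \<comment> \<open>Coprimality cancels the second factors in \<open>x * y = x' * y'\<close>, so
      \<open>x\<close> and \<open>x'\<close> divide each other.\<close>
    have "coprime x y'" "coprime x' y"
      using dvd assms(1) by (blast intro: coprime_divisors)+
    moreover have "x dvd x' * y'" "x' dvd x * y" using *(5) by (metis dvd_triv_left)+
    ultimately have "x dvd x'" "x' dvd x" by (auto simp: coprime_dvd_mult_left_iff)
    then have "x = x'" by (rule dvd_antisym)
    then show "x = x' \<and> y = y'" using *(5) \<open>x > 0\<close> by simp
  qed
  have "usigma (m * n) = (\<Sum>(x, y) \<in> ?U m \<times> ?U n. x * y)"
    unfolding usigma_def unitary_divisors_mult[OF assms]
    by (subst sum.reindex[OF inj]) (simp add: case_prod_unfold)
  also have "\<dots> = usigma m * usigma n"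
    unfolding usigma_def by (simp add: sum_product sum.cartesian_product)
  finally show ?thesis .
qed

lemma usigma_prime_power:
  assumes "prime p" "e > 0"
  shows "usigma (p ^ e) = p ^ e + 1"
proof -
  have pos: "p ^ e > 0" using assms by (simp add: prime_gt_0_nat)
  have "unitary_divisor d (p ^ e) \<longleftrightarrow> d = 1 \<or> d = p ^ e" for d
  proof
    assume "unitary_divisor d (p ^ e)"
    then obtain k where k: "p ^ e = d * k" "coprime d k"
      using pos by (auto simp: unitary_divisor_iff)
    show "d = 1 \<or> d = p ^ e"
    proof (rule ccontr)
      assume "\<not> ?thesis"
      \<comment> \<open>Both \<open>d\<close> and \<open>k\<close> are powers of \<open>p\<close>;
        if neither is 1, they share the divisor \<open>p\<close>.\<close>
      then have "d \<noteq> 1" "k \<noteq> 1" using k by auto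
      moreover obtain i where "d = p ^ i"
        using k(1) assms divides_primepow_nat by (metis dvd_triv_left)
      moreover obtain j where "k = p ^ j"
        using k(1) assms divides_primepow_nat by (metis dvd_triv_right)
      ultimately have "p dvd d" "p dvd k" by (auto intro: dvd_power gr0I)
      then show False using k(2) assms(1) by (metis coprime_common_divisor not_prime_unit)
    qed
  next
    assume "d = 1 \<or> d = p ^ e"
    then show "unitary_divisor d (p ^ e)" using pos by (auto simp: unitary_divisor_def)
  qed
  then have "{d. unitary_divisor d (p ^ e)} = {1, p ^ e}" by auto
  then have "usigma (p ^ e) = \<Sum>{1, p ^ e}" by (simp add: usigma_def)
  moreover have "1 < p ^ e" using assms by (intro one_less_power prime_gt_1_nat)
  ultimately show ?thesis by simp
qed

lemma usigma_prod:
  assumes "finite A" "\<And>x y. x \<in> A \<Longrightarrow> y \<in> A \<Longrightarrow> x \<noteq> y \<Longrightarrow> coprime (g x) (g y)"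
    "\<And>x. x \<in> A \<Longrightarrow> g x > 0"
  shows "usigma (\<Prod>x\<in>A. g x) = (\<Prod>x\<in>A. usigma (g x))"
  using assms
proof (induction A rule: finite_induct)
  case empty
  have "{d. unitary_divisor d 1} = {1}" by (auto simp: unitary_divisor_def)
  then show ?case by (simp add: usigma_def)
next
  case (insert x A)
  have "coprime (g x) (\<Prod>x\<in>A. g x)"
    using insert.prems(1) insert.hyps by (intro prod_coprime_right) blast
  moreover have "(\<Prod>x\<in>A. g x) > 0" "g x > 0" using insert.prems(2) by (auto intro: prod_pos)
  ultimately show ?case using insert by (simp add: usigma_mult)
qed

lemma usigma_prime_factorization:
  assumes "n > 0"
  shows "usigma n = (\<Prod>p\<in>prime_factors n. p ^ multiplicity p n + 1)"
proof -
  have "usigma n = usigma (\<Prod>p\<in>prime_factors n. p ^ multiplicity p n)"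
    using assms prime_factorization_nat by simp
  also have "\<dots> = (\<Prod>p\<in>prime_factors n. usigma (p ^ multiplicity p n))"
    by (rule usigma_prod)
      (auto simp: primes_coprime prime_gt_0_nat in_prime_factors_iff)
  also have "\<dots> = (\<Prod>p\<in>prime_factors n. p ^ multiplicity p n + 1)"
    by (intro prod.cong usigma_prime_power)
      (auto simp: in_prime_factors_iff prime_multiplicity_gt_zero_iff)
  finally show ?thesis .
qed

section \<open>Divisors of \<open>x^2 + 1\<close>, \<open>x^2 + 2\<close> and
  \<open>x^2 + 5\<close>\<close>

text \<open>The descent step. Since \<open>m\<close> is odd, \<open>x mod m\<close> and its negative
  \<open>m - x mod m\<close> have opposite parities, so one of them has the parity prescribed by
  \<open>b\<close>. Being below \<open>m\<close>, it yields a cofactor below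
  \<open>m\<close>.\<close>

lemma dvd_square_plus_reduce:
  fixes m x c :: nat
  assumes "odd m" "0 < c" "c < m" "m dvd x\<^sup>2 + c"
  obtains y k where "y\<^sup>2 + c = m * k" "k < m" "even y \<longleftrightarrow> b"
proof -
  define z where "z = x mod m"
  have "z < m" using assms by (simp add: z_def)
  have "[z\<^sup>2 + c = x\<^sup>2 + c] (mod m)"
    unfolding z_def by (intro cong_add cong_pow) (auto simp: cong_def)
  then have z: "m dvd z\<^sup>2 + c" using assms(4) cong_dvd_iff by blast
  \<comment> \<open>The passage to integers is due to \<open>m - 2 * z\<close>, which may be
    negative.\<close>
  have "int m dvd int m * (int m - 2 * int z) + (int z ^ 2 + int c)"
    using z by (metis dvd_add dvd_triv_left of_nat_add of_nat_dvd_iff of_nat_power)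
  also have "\<dots> = int ((m - z)\<^sup>2 + c)"
    using \<open>z < m\<close> by (simp add: of_nat_diff power2_diff) (simp add: power2_eq_square algebra_simps)
  finally have mz: "m dvd (m - z)\<^sup>2 + c" by (subst (asm) of_nat_dvd_iff)
  obtain y where y: "even y \<longleftrightarrow> b" "m dvd y\<^sup>2 + c" "y \<le> m"
  proof (cases "even z \<longleftrightarrow> b")
    case True
    then show ?thesis using that[of z] z \<open>z < m\<close> by simp
  next
    case False
    then have "even (m - z) \<longleftrightarrow> b" using \<open>odd m\<close> \<open>z < m\<close> by auto
    then show ?thesis using that[of "m - z"] mz by simp
  qed
  have "y \<noteq> m"
  proof
    assume "y = m"
    then have "m dvd c" using y(2) by (simp add: dvd_add_right_iff power2_eq_square)
    then show False using assms by (auto dest: dvd_imp_le)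
  qed
  then have "y \<le> m - 1" using y(3) by simp
  then have "y\<^sup>2 \<le> (m - 1)\<^sup>2" by (rule power_mono) simp
  moreover obtain k where k: "y\<^sup>2 + c = m * k" using y(2) by (auto elim: dvdE)
  moreover have "(m - 1)\<^sup>2 + c < m * m"
  proof -
    obtain n where "m = Suc n" using assms(3) by (cases m) auto
    then show ?thesis using assms(3) by (simp add: power2_eq_square)
  qed
  ultimately have "m * k < m * m" by linarith
  then have "k < m" by simp
  then show ?thesis using that k y(1) by blast
qed

text \<open>
  Descent instead of quadratic reciprocity: if \<open>m\<close> lies in the listed residue classes, so does the
  smaller cofactor \<open>k\<close> with \<open>y\<^sup>2 + c = m k\<close>. Primality of \<open>m\<close> plays no role.
\<close>

lemma not_dvd_square_plus_1:
  fixes m x :: nat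
  assumes "m mod 4 = 3"
  shows "\<not> m dvd x\<^sup>2 + 1"
  using assms
proof (induction m arbitrary: x rule: less_induct)
  case (less m)
  show ?case
  proof
    assume "m dvd x\<^sup>2 + 1"
    moreover have "odd m" "1 < m" using less.prems by presburger+
    ultimately obtain y k where y: "y\<^sup>2 + 1 = m * k" "k < m" "even y"
      using dvd_square_plus_reduce[of m 1 x True] by auto
    from y(3) obtain t where "y = 2 * t" by (rule evenE)
    then have "(y\<^sup>2 + 1) mod 4 = 1" by (simp add: power2_eq_square)
    then have "(m mod 4) * (k mod 4) mod 4 = 1" using y(1) by (simp add: mod_mult_eq)
    moreover have "k mod 4 \<in> {0, 1, 2, 3}" by simp presburger
    ultimately have "k mod 4 = 3" using less.prems by auto
    moreover have "k dvd y\<^sup>2 + 1" using y(1) by simp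
    ultimately show False using less.IH y(2) by blast
  qed
qed

lemma not_dvd_square_plus_2:
  fixes m x :: nat
  assumes "m mod 8 \<in> {5, 7}"
  shows "\<not> m dvd x\<^sup>2 + 2"
  using assms
proof (induction m arbitrary: x rule: less_induct)
  case (less m)
  show ?case
  proof
    assume "m dvd x\<^sup>2 + 2"
    moreover have "odd m" "2 < m" using less.prems by auto presburger+
    ultimately obtain y k where y: "y\<^sup>2 + 2 = m * k" "k < m" "odd y"
      using dvd_square_plus_reduce[of m 2 x False] by auto
    have "[y\<^sup>2 = 1] (mod 8)"
    proof -
      have "y mod 8 \<in> {1, 3, 5, 7}" using y(3) by simp presburger
      then have "(y mod 8)\<^sup>2 mod 8 = 1" by auto
      then show ?thesis by (simp add: cong_def power_mod)
    qed
    \<comment> \<open>The odd choice of \<open>y\<close> fixes the product of \<open>m\<close> and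
      \<open>k\<close> as 3 modulo 8. As 5 * 7 is 3 modulo 8, the residues 5 and 7 are
      exchanged.\<close>
    then have "(y\<^sup>2 + 2) mod 8 = 3"
      using mod_add_left_eq[of "y\<^sup>2" 8 2] by (simp add: cong_def)
    then have "(m mod 8) * (k mod 8) mod 8 = 3" using y(1) by (simp add: mod_mult_eq)
    moreover have "k mod 8 \<in> {0, 1, 2, 3, 4, 5, 6, 7}" by simp presburger
    ultimately have "k mod 8 \<in> {5, 7}" using less.prems by auto
    moreover have "k dvd y\<^sup>2 + 2" using y(1) by simp
    ultimately show False using less.IH y(2) by blast
  qed
qed

lemma not_dvd_square_plus_5:
  fixes m x :: nat
  assumes "m mod 20 \<in> {11, 13, 17, 19}"
  shows "\<not> m dvd x\<^sup>2 + 5"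
  using assms
proof (induction m arbitrary: x rule: less_induct)
  case (less m)
  \<comment> \<open>The set of these four residues is closed under inversion and under
    multiplication by 9 modulo 20; \<open>i\<close> is the inverse of \<open>m\<close>.\<close>
  have residue: "k mod 20 \<in> {11, 13, 17, 19}" if "m * k mod 20 \<in> {1, 9}" for k
  proof -
    have "\<exists>i\<in>{11, 13, 17, 19}. i * (m mod 20) mod 20 = 1" using less.prems by auto
    then obtain i where i: "i \<in> {11, 13, 17, 19}" "i * m mod 20 = 1"
      by (auto simp: mod_mult_right_eq)
    have "k mod 20 = (i * m mod 20) * k mod 20" using i(2) by simp
    also have "\<dots> = i * (m * k mod 20) mod 20"
      by (simp add: mod_mult_left_eq mod_mult_right_eq mult.assoc)
    finally show ?thesis using that i(1) by auto
  qed
  show ?case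
  proof
    assume "m dvd x\<^sup>2 + 5"
    moreover have "odd m" "5 < m" using less.prems by auto presburger+
    ultimately obtain y k where y: "y\<^sup>2 + 5 = m * k" "k < m" "even y"
      using dvd_square_plus_reduce[of m 5 x True] by auto
    \<comment> \<open>If 5 divides \<open>y\<close>, then 5 cancels from \<open>y^2 + 5\<close> and
      \<open>k\<close>, leaving the product 1 modulo 20. Otherwise \<open>k\<close> itself serves,
      because \<open>4 * z^2 + 5\<close> is 9 or 1 modulo 20.\<close>
    obtain k' where k': "k' dvd k" "m * k' mod 20 \<in> {1, 9}"
    proof (cases "5 dvd y")
      case True
      then have "10 dvd y" using y(3) by presburger
      then obtain t where "y = 10 * t" by (rule dvdE)
      then have mk: "m * k = 5 * (20 * t\<^sup>2 + 1)"
        using y(1) by (simp add: power2_eq_square)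
      then have "5 dvd m * k" by simp
      moreover have "prime (5::nat)" by simp
      moreover have "\<not> 5 dvd m" using less.prems by auto presburger+
      ultimately have "5 dvd k" by (simp add: prime_dvd_mult_iff)
      then obtain k' where "k = 5 * k'" by (rule dvdE)
      moreover from this have "m * k' = 20 * t\<^sup>2 + 1" using mk by simp
      ultimately show ?thesis using that[of k'] by simp
    next
      case False
      obtain z where z: "y = 2 * z" using y(3) by (rule evenE)
      then have "z mod 5 \<in> {1, 2, 3, 4}" using False by simp presburger
      then have "(z mod 5)\<^sup>2 mod 5 = 1 \<or> (z mod 5)\<^sup>2 mod 5 = 4" by auto
      then have "z\<^sup>2 mod 5 = 1 \<or> z\<^sup>2 mod 5 = 4" by (simp add: power_mod)
      moreover have "(4 * z\<^sup>2 + 5) mod 20 = (4 * (z\<^sup>2 mod 5) + 5) mod 20"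
        by (simp add: mult_mod_right mod_add_left_eq)
      ultimately have "(y\<^sup>2 + 5) mod 20 \<in> {1, 9}" by (auto simp: z power_mult_distrib)
      then show ?thesis using that[of k] y(1) by simp
    qed
    have "k > 0" using y(1) by (intro gr0I) auto
    then have "k' < m" using k'(1) y(2) by (auto dest: dvd_imp_le)
    moreover have "k' dvd y\<^sup>2 + 5" using k'(1) y(1) by simp
    ultimately show False using less.IH residue[OF k'(2)] by blast
  qed
qed

text \<open>For even \<open>f\<close>, \<open>2 ^ f + 1\<close> is a square plus 1; for odd
  \<open>f\<close>, its double is a square plus 2.\<close>

lemma dvd_two_power_plus_1:
  fixes p f :: nat
  assumes "p dvd 2 ^ f + 1"
  shows "p mod 8 \<noteq> 7" "even f \<Longrightarrow> p mod 4 \<noteq> 3"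
proof -
  show 4: "p mod 4 \<noteq> 3" if "even f"
    using not_dvd_square_plus_1[of p "2 ^ (f div 2)"] assms that
    by (auto simp flip: power_mult)
  show "p mod 8 \<noteq> 7"
  proof (cases "even f")
    case True
    show ?thesis using 4[OF True] by presburger
  next
    case False
    then obtain j where "f = 2 * j + 1" by (rule oddE)
    then have *: "2 * (2 ^ f + 1) = (2 ^ (j + 1))\<^sup>2 + (2::nat)"
      by (simp add: power_mult power2_eq_square flip: power_mult_distrib)
    have "p dvd 2 * (2 ^ f + 1)" using assms(1) by (rule dvd_mult)
    then show ?thesis
      unfolding * using not_dvd_square_plus_2[of p "2 ^ (j + 1)"] by blast
  qed
qed

text \<open>An even \<open>f\<close> would make \<open>5 ^ f + 1\<close> a square plus 1. For odd
  \<open>f\<close>, five times it is a square plus 5, which excludes the residue 19 modulo 20, that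
  is, 3 modulo 4 together with 4 modulo 5.\<close>

lemma dvd_five_power_plus_1:
  fixes p f :: nat
  assumes "p dvd 5 ^ f + 1" "p mod 4 = 3"
  shows "odd f" "p mod 5 \<noteq> 4"
proof -
  show "odd f"
    using not_dvd_square_plus_1[of p "5 ^ (f div 2)"] assms
    by (auto simp flip: power_mult)
  then obtain j where "f = 2 * j + 1" by (rule oddE)
  then have *: "5 * (5 ^ f + 1) = (5 ^ (j + 1))\<^sup>2 + (5::nat)"
    by (simp add: power_mult power2_eq_square flip: power_mult_distrib)
  have "p dvd 5 * (5 ^ f + 1)" using assms(1) by (rule dvd_mult)
  then have 20: "p mod 20 \<noteq> 19"
    unfolding * using not_dvd_square_plus_5[of p "5 ^ (j + 1)"] by blast
  show "p mod 5 \<noteq> 4"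
  proof
    assume "p mod 5 = 4"
    then have "5 dvd p + 1" "4 dvd p + 1" using assms(2) by presburger+
    then have "5 * 4 dvd p + 1" using coprime_Suc_left_nat[of 4] by (intro divides_mult) simp_all
    then have "p mod 20 = 19" by simp presburger
    then show False using 20 by contradiction
  qed
qed

section \<open>Estimates for sums of reciprocals and for products\<close>

lemma sum_inverse_geometric_le:
  fixes c r :: nat
  assumes "S \<subseteq> range (\<lambda>k. c * r ^ k)" "finite S" "c > 0" "r > 1"
  shows "(\<Sum>x\<in>S. 1 / real x) \<le> real r / (real c * (real r - 1))"
proof -
  have inj: "inj (\<lambda>k. c * r ^ k)" using assms by (auto simp: inj_def power_inject_exp)
  obtain K where K: "S = (\<lambda>k. c * r ^ k) ` K" using assms(1) by (auto simp: subset_image_iff)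
  have "finite K" using assms(2) inj unfolding K by (metis finite_imageD inj_on_subset subset_UNIV)
  have "(\<Sum>x\<in>S. 1 / real x) = (\<Sum>k\<in>K. (1 / r) ^ k) / c"
    unfolding K by (subst sum.reindex[OF inj_on_subset[OF inj]])
      (auto simp: sum_divide_distrib power_one_over field_simps)
  also have "(\<Sum>k\<in>K. (1 / r) ^ k) \<le> (\<Sum>k. (1 / real r) ^ k)"
    using assms \<open>finite K\<close> by (intro sum_le_suminf summable_geometric) auto
  also have "\<dots> = 1 / (1 - 1 / real r)"
    using assms by (intro suminf_geometric) auto
  also have "\<dots> / c = real r / (real c * (real r - 1))"
    using assms by (simp add: field_simps of_nat_diff)
  finally show ?thesis using assms by (simp add: divide_right_mono)
qed

text \<open>The Weierstrass product inequality.\<close>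

lemma one_minus_sum_le_prod:
  fixes f :: "'a \<Rightarrow> real"
  assumes "finite A" "\<And>x. x \<in> A \<Longrightarrow> 0 \<le> f x" "\<And>x. x \<in> A \<Longrightarrow> f x \<le> 1"
  shows "1 - sum f A \<le> (\<Prod>x\<in>A. 1 - f x)"
  using assms
proof (induction A rule: finite_induct)
  case (insert a A)
  have "(\<Prod>x\<in>A. 1 - f x) \<le> 1" using insert.prems by (intro prod_le_1) auto
  then have "f a * (\<Prod>x\<in>A. 1 - f x) \<le> f a" using insert.prems(1)[of a] by (simp add: mult_left_le)
  then show ?case using insert by (simp add: algebra_simps)
qed simp

lemma sum_le_cover:
  fixes f :: "'a \<Rightarrow> real"
  assumes "finite S" "S \<subseteq> X \<union> Y" "\<And>x. f x \<ge> 0"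
  shows "sum f S \<le> sum f (S \<inter> X) + sum f (S \<inter> Y)"
proof -
  have "S = (S \<inter> X) \<union> (S \<inter> Y)" using assms(2) by blast
  then have "sum f S = sum f (S \<inter> X) + sum f (S \<inter> Y) - sum f ((S \<inter> X) \<inter> (S \<inter> Y))"
    using sum_Un[of "S \<inter> X" "S \<inter> Y" f] assms(1) by simp
  moreover have "sum f ((S \<inter> X) \<inter> (S \<inter> Y)) \<ge> 0" using assms(3) by (rule sum_nonneg)
  ultimately show ?thesis by linarith
qed

section \<open>Divisibility and residues of prime powers\<close>

lemma dvd_prime_powers_mult:
  fixes d :: nat
  assumes "d dvd p ^ m * q ^ n" "prime p" "prime q"
  obtains a b where "d = p ^ a * q ^ b"
  using division_decomp[OF assms(1)] assms(2,3) by (auto simp: divides_primepow_nat)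

lemma two_power_dvd_iff:
  fixes y :: nat
  assumes "odd y"
  shows "2 ^ k dvd 2 ^ a * y \<longleftrightarrow> k \<le> a"
  using assms by (subst coprime_dvd_mult_left_iff) (simp_all add: dvd_power_iff_le)

text \<open>Odd squares are 1 modulo 8. Hence \<open>e\<close> cannot be even, and
  \<open>p ^ e\<close> is such a square times \<open>p\<close>.\<close>

lemma power_mod_4_eq_3:
  fixes p e :: nat
  assumes "p ^ e mod 4 = 3"
  shows "p mod 4 = 3" "odd e" "p ^ e mod 8 = p mod 8"
proof -
  have "odd (p ^ e)" using assms by presburger
  then have "odd (p ^ (e div 2))" by (cases "e = 0") auto
  moreover have "x mod 8 \<in> {1, 3, 5, 7}" if "odd x" for x :: nat
    using that by simp presburger
  ultimately have "p ^ (e div 2) mod 8 \<in> {1, 3, 5, 7}" by blast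
  then have "(p ^ (e div 2) mod 8)\<^sup>2 mod 8 = 1" by auto
  then have sq: "(p ^ (e div 2))\<^sup>2 mod 8 = 1" by (simp add: power_mod)
  show "odd e"
  proof
    assume "even e"
    then have "p ^ e mod 8 = 1" using sq by (simp flip: power_mult)
    then show False using assms by presburger
  qed
  then have "p ^ e = (p ^ (e div 2))\<^sup>2 * p"
    by (metis odd_two_times_div_two_succ power_add power_mult power_one_right mult.commute)
  then have "p ^ e mod 8 = ((p ^ (e div 2))\<^sup>2 mod 8) * p mod 8" by (simp add: mod_mult_left_eq)
  also have "\<dots> = p mod 8" unfolding sq by simp
  finally show 8: "p ^ e mod 8 = p mod 8" .
  show "p mod 4 = 3"
    using 8 assms mod_mod_cancel[of 4 8 p] mod_mod_cancel[of 4 8 "p ^ e"] by simp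
qed

text \<open>The power is a square times \<open>p\<close>, and squares are 0, 1 or 4 modulo 5, so
  \<open>p\<close> is 1 or 4; in the former case all its powers would be 1.\<close>

lemma odd_power_mod_5_eq_4:
  fixes p e :: nat
  assumes "p ^ e mod 5 = 4" "odd e"
  shows "p mod 5 = 4"
proof -
  have pm: "p ^ e mod 5 = (p mod 5) ^ e mod 5" by (simp add: power_mod)
  obtain k where k: "e = 2 * k + 1" using assms(2) by (rule oddE)
  have "p ^ e = (p ^ k)\<^sup>2 * p" using k by (simp add: power_mult mult.commute)
  then have "p ^ e mod 5 = ((p ^ k)\<^sup>2 mod 5) * (p mod 5) mod 5" by (simp add: mod_mult_eq)
  also have "(p ^ k)\<^sup>2 mod 5 = (p ^ k mod 5)\<^sup>2 mod 5" by (simp add: power_mod)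
  finally have eq: "(p ^ k mod 5)\<^sup>2 mod 5 * (p mod 5) mod 5 = 4" using assms(1) by simp
  have "p ^ k mod 5 \<in> {0, 1, 2, 3, 4}" by simp presburger
  then have "(p ^ k mod 5)\<^sup>2 mod 5 \<in> {0, 1, 4}" by auto
  moreover have "p mod 5 \<in> {0, 1, 2, 3, 4}" by simp presburger
  ultimately have "p mod 5 \<in> {1, 4}" using eq by auto
  moreover have "p mod 5 \<noteq> 1" using pm assms(1) by auto
  ultimately show ?thesis by simp
qed

lemma three_dvd_odd_power_plus_1:
  fixes c f :: nat
  assumes "c mod 3 = 2" "odd f"
  shows "3 dvd c ^ f + 1"
proof -
  obtain k where k: "f = 2 * k + 1" using assms(2) by (rule oddE)
  have "c ^ f mod 3 = 2 ^ f mod 3" using assms(1) by (metis power_mod)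
  also have "2 ^ f = 4 ^ k * (2::nat)" using k by (simp add: power_mult)
  also have "\<dots> mod 3 = (4 mod 3) ^ k * 2 mod 3" by (metis mod_mult_left_eq power_mod)
  also have "\<dots> = 2" by simp
  finally show ?thesis by presburger
qed

section \<open>The case \<open>q = 5\<close>: shape of the prime power components of
  \<open>N\<close>\<close>

locale unitary_superperfect_five =
  fixes N f1 f2 :: nat
  assumes odd_N: "odd N"
    and double: "2 * N = (2 ^ f1 + 1) * (5 ^ f2 + 1)"
    and usigma_N: "usigma N = 2 ^ f1 * 5 ^ f2"
    and f1_pos: "f1 > 0" and f2_pos: "f2 > 0"
begin

definition component :: "nat \<Rightarrow> nat" where
  "component p = p ^ multiplicity p N"

text \<open>A set loses no multiplicities here, since distinct primes give distinct values
  (\<open>component_inj\<close>).\<close>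

definition factors :: "nat set" where
  "factors = (\<lambda>p. component p + 1) ` prime_factors N"

lemma N_pos: "N > 0"
  using odd_N by (rule odd_pos)

lemma finite_factors: "finite factors"
  by (simp add: factors_def)

lemma prod_factors: "(\<Prod>p\<in>prime_factors N. component p + 1) = 2 ^ f1 * 5 ^ f2"
  using usigma_prime_factorization[OF N_pos] usigma_N by (simp add: component_def)

lemma prod_component: "(\<Prod>p\<in>prime_factors N. component p) = N"
  using prime_factorization_nat[OF N_pos] by (simp add: component_def)

lemma multiplicity_pos: "p \<in> prime_factors N \<Longrightarrow> multiplicity p N > 0"
  by (auto simp: prime_factors_multiplicity)

lemma dvd_component: "p \<in> prime_factors N \<Longrightarrow> p dvd component p"
  using multiplicity_pos by (simp add: component_def)

lemma component_eq_prime_power: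
  assumes "p \<in> prime_factors N" "component p = r ^ k" "prime r"
  shows "p = r"
proof -
  have "p dvd r" using dvd_component[OF assms(1)] assms(1,2) 
    by (auto intro: prime_dvd_power)
  then show ?thesis
    using assms(1,3) primes_dvd_imp_eq in_prime_factors_imp_prime by blast
qed

lemma component_inj: "inj_on (\<lambda>p. component p + 1) (prime_factors N)"
  by (rule inj_onI) (auto simp: component_def intro: component_eq_prime_power)

lemma component_pos: "p \<in> prime_factors N \<Longrightarrow> component p > 1"
  unfolding component_def using multiplicity_pos[of p]
  by (intro one_less_power prime_gt_1_nat) auto

text \<open>The quotient \<open>N / usigma N\<close> is bounded below through the prime factors and
  evaluated exactly through \<open>double\<close>.\<close>

lemma one_minus_sum_factors_le:
  "1 - (\<Sum>x\<in>factors. 1 / real x) \<le> (1 + 1 / 2 ^ f1) * (1 + 1 / 5 ^ f2) / 2"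
proof -
  have "(\<Sum>x\<in>factors. 1 / real x) = (\<Sum>p\<in>prime_factors N. 1 / real (component p + 1))"
    unfolding factors_def by (subst sum.reindex[OF component_inj]) simp
  then have "1 - (\<Sum>x\<in>factors. 1 / real x)
      \<le> (\<Prod>p\<in>prime_factors N. 1 - 1 / real (component p + 1))"
    using one_minus_sum_le_prod[of "prime_factors N" "\<lambda>p. 1 / real (component p + 1)"] by simp
  also have "\<dots> = (\<Prod>p\<in>prime_factors N. real (component p) / real (component p + 1))"
    by (intro prod.cong) (auto simp: field_simps)
  also have "\<dots> = real N / (2 ^ f1 * 5 ^ f2)"
    unfolding prod_dividef
    by (simp only: prod_component prod_factors flip: of_nat_prod) simp
  also have "real N = (2 ^ f1 + 1) * (5 ^ f2 + 1) / 2"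
    using arg_cong[OF double, of real] unfolding of_nat_mult by (simp add: add.commute)
  also have "\<dots> / (2 ^ f1 * 5 ^ f2) = (1 + 1 / 2 ^ f1) * (1 + 1 / 5 ^ f2) / (2::real)"
    by (simp add: field_simps)
  finally show ?thesis .
qed

lemma prime_factor_cases:
  assumes "p \<in> prime_factors N"
  obtains "p dvd 2 ^ f1 + 1" | "p dvd 5 ^ f2 + 1"
proof -
  have "p dvd (2 ^ f1 + 1) * (5 ^ f2 + 1)" using assms double
    by (metis dvd_mult in_prime_factors_imp_dvd)
  then show ?thesis using assms that by (metis in_prime_factors_imp_prime prime_dvd_mult_iff)
qed

text \<open>The cases are named after the residue of the component: 1 modulo 4, 3 modulo 8, 7 modulo
  8. This residue controls the exponent \<open>a\<close> in
  \<open>component p + 1 = 2 ^ a * 5 ^ b\<close>.\<close>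

lemma component_cases:
  assumes p: "p \<in> prime_factors N"
  obtains (one) b where "component p + 1 = 10 * 5 ^ b"
  | (three) b where "component p + 1 = 4 * 5 ^ b" "p mod 8 = 3" "p dvd 2 ^ f1 + 1 \<or> b = 0"
  | (seven) k where "component p + 1 = 8 * 4 ^ k" "p mod 8 = 7" "odd f2" "f2 > 1"
proof -
  have prime_p: "prime p" using p by auto
  have "component p + 1 dvd 2 ^ f1 * 5 ^ f2"
    using p dvd_prodI[of "prime_factors N" p "\<lambda>p. component p + 1"]
    unfolding prod_factors by simp
  then obtain a b where ab: "component p + 1 = 2 ^ a * 5 ^ b"
    by (rule dvd_prime_powers_mult) auto
  have pow: "2 ^ k dvd component p + 1 \<longleftrightarrow> k \<le> a" for k
    unfolding ab by (rule two_power_dvd_iff) simp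
  have "odd (component p)"
    using odd_N multiplicity_dvd[of p N] unfolding component_def by (meson dvd_trans)
  then have "component p mod 4 = 1 \<or> component p mod 4 = 3" by presburger
  then show ?thesis
  proof
    assume 1: "component p mod 4 = 1"
    then have "2 dvd component p + 1" "\<not> 4 dvd component p + 1" by presburger+
    then have "a = 1" using pow[of 1] pow[of 2] by simp
    have "b \<noteq> 0" using ab component_pos[OF p] \<open>a = 1\<close> by (intro notI) simp
    then obtain b' where "b = Suc b'" by (cases b) auto
    then show ?thesis using one[of b'] ab \<open>a = 1\<close> by simp
  next
    assume 2: "component p mod 4 = 3"
    note e = power_mod_4_eq_3[OF 2[unfolded component_def]]
    \<comment> \<open>A factor 5 of \<open>component p + 1\<close> would make the component, and by
      the odd exponent also \<open>p\<close>, equal to 4 modulo 5.\<close>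
    have b0: "b = 0" if "p dvd 5 ^ f2 + 1"
    proof (rule ccontr)
      assume "b \<noteq> 0"
      then have "5 dvd component p + 1" using ab by simp
      then have "component p mod 5 = 4" by presburger
      then have "p mod 5 = 4"
        unfolding component_def using e(2) by (rule odd_power_mod_5_eq_4)
      then show False using dvd_five_power_plus_1(2)[OF that e(1)] by simp
    qed
    have "p mod 8 = 3 \<or> p mod 8 = 7" using e(1) by presburger
    then show ?thesis
    proof
      assume 3: "p mod 8 = 3"
      then have c: "component p mod 8 = 3" using e(3) by (simp add: component_def)
      then have "4 dvd component p + 1" "\<not> 8 dvd component p + 1" by presburger+
      then have "a = 2" using pow[of 2] pow[of 3] by simp
      then show ?thesis using three[of b] ab 3 b0 prime_factor_cases[OF p] by auto
    next
      assume 7: "p mod 8 = 7"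
      then have c: "component p mod 8 = 7" using e(3) by (simp add: component_def)
      have dvd5: "p dvd 5 ^ f2 + 1"
        using dvd_two_power_plus_1(1)[of p f1] 7 prime_factor_cases[OF p] by blast
      then have "b = 0" by (rule b0)
      have "odd f2" using dvd_five_power_plus_1(1)[OF dvd5 e(1)] .
      moreover have "f2 \<noteq> 1"
      proof
        assume "f2 = 1"
        then have "p dvd 6" using dvd5 by simp
        then have "p \<le> 6" by (rule dvd_imp_le) simp
        then show False using 7 by simp
      qed
      \<comment> \<open>For even \<open>a\<close>, \<open>component p + 1\<close> is a power of 4,
        hence 1 modulo 3; this forces \<open>p = 3\<close>, which is not 7 modulo 8.\<close>
      moreover have "odd a"
      proof
        assume "even a"
        then obtain j where "a = 2 * j" by (rule evenE)
        then have j: "component p + 1 = 4 ^ j" using ab \<open>b = 0\<close> by (simp add: power_mult)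
        have "(4::nat) ^ j mod 3 = (4 mod 3) ^ j mod 3" by (simp only: power_mod)
        then have "(component p + 1) mod 3 = 1" unfolding j by simp
        then have "3 dvd p ^ multiplicity p N" unfolding component_def by presburger
        moreover have "prime (3::nat)" by simp
        ultimately have "3 dvd p" by (rule prime_dvd_power[rotated])
        then have "p = 3" using prime_p primes_dvd_imp_eq[of 3 p] by simp
        then show False using 7 by simp
      qed
      moreover have "a \<noteq> 1" using ab \<open>b = 0\<close> c by (intro notI) simp
      moreover have "\<exists>k. a = 2 * k + 3" if "odd a" "a \<noteq> 1" using that by presburger
      ultimately obtain k where "a = 2 * k + 3" by blast
      then have "component p + 1 = 8 * 4 ^ k" using ab \<open>b = 0\<close> by (simp add: power_add power_mult)
      then show ?thesis using seven[of k] 7 \<open>odd f2\<close> \<open>f2 \<noteq> 1\<close> f2_pos by simp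
    qed
  qed
qed

text \<open>
  The factors 4 and 10 exclude each other, since they come from \<open>P = 3\<close> and \<open>P = 9\<close>.
\<close>

lemma four_not_in_factors:
  assumes "component 3 \<noteq> 3"
  shows "4 \<notin> factors"
proof
  assume "4 \<in> factors"
  then obtain p where p: "p \<in> prime_factors N" "component p = 3" by (auto simp: factors_def)
  then have "p = 3" using component_eq_prime_power[of p 3 1] by simp
  then show False using p assms by simp
qed

lemma ten_not_in_factors:
  assumes "component 3 \<noteq> 9"
  shows "10 \<notin> factors"
proof
  assume "10 \<in> factors"
  then obtain p where p: "p \<in> prime_factors N" "component p = 9" by (auto simp: factors_def)
  then have "p = 3" using component_eq_prime_power[of p 3 2] by simp
  then show False using p assms by simp
qed

text \<open>Case \<open>one\<close> would make 5 divide both \<open>component 5\<close> and its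
  successor; the other two cases fail because 5 is neither 3 nor 7 modulo 8.\<close>

lemma not_5_dvd: "\<not> 5 dvd N"
proof
  assume "5 dvd N"
  then have p: "5 \<in> prime_factors N" using N_pos by (simp add: in_prime_factors_iff)
  have "5 dvd component 5" using dvd_component[OF p] .
  then have "\<not> 5 dvd component 5 + 1" by presburger
  then show False by (cases rule: component_cases[OF p]) simp_all
qed

section \<open>Covering \<open>factors\<close> by geometric progressions\<close>

definition geometric :: "nat \<Rightarrow> nat \<Rightarrow> nat set" where
  "geometric c r = range (\<lambda>k. c * r ^ k)"

lemma sum_geometric_le:
  assumes "c > 0" "r > 1"
  shows "(\<Sum>x\<in>factors \<inter> geometric c r. 1 / real x) \<le> real r / (real c * (real r - 1))"
  using assms finite_factors by (intro sum_inverse_geometric_le) (auto simp: geometric_def)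

lemma sum_cover2:
  assumes "factors \<subseteq> geometric c r \<union> geometric d s" "c > 0" "r > 1" "d > 0" "s > 1"
  shows "(\<Sum>x\<in>factors. 1 / real x) \<le> real r / (real c * (real r - 1)) + real s / (real d * (real s - 1))"
  using sum_le_cover[OF finite_factors assms(1), of "\<lambda>x. 1 / real x", OF divide_nonneg_nonneg]
    sum_geometric_le[OF assms(2,3)] sum_geometric_le[OF assms(4,5)] by linarith

text \<open>The set \<open>Z\<close> stays general, to serve both for the single value 4 and for a
  third progression.\<close>

lemma sum_cover3:
  assumes "factors \<subseteq> geometric c r \<union> geometric d s \<union> Z" "c > 0" "r > 1" "d > 0" "s > 1"
  shows "(\<Sum>x\<in>factors. 1 / real x)
    \<le> real r / (real c * (real r - 1)) + real s / (real d * (real s - 1)) + (\<Sum>x\<in>factors \<inter> Z. 1 / real x)"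
proof -
  have "(\<Sum>x\<in>factors. 1 / real x) \<le> (\<Sum>x\<in>factors \<inter> (geometric c r \<union> geometric d s). 1 / real x)
      + (\<Sum>x\<in>factors \<inter> Z. 1 / real x)"
    using finite_factors assms(1) by (rule sum_le_cover) simp
  moreover have "(\<Sum>x\<in>factors \<inter> (geometric c r \<union> geometric d s). 1 / real x)
      \<le> (\<Sum>x\<in>factors \<inter> (geometric c r \<union> geometric d s) \<inter> geometric c r. 1 / real x)
      + (\<Sum>x\<in>factors \<inter> (geometric c r \<union> geometric d s) \<inter> geometric d s. 1 / real x)"
    using finite_factors by (intro sum_le_cover) auto
  moreover have "factors \<inter> (geometric c r \<union> geometric d s) \<inter> geometric c r = factors \<inter> geometric c r"
    "factors \<inter> (geometric c r \<union> geometric d s) \<inter> geometric d s = factors \<inter> geometric d s"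
    by auto
  ultimately show ?thesis
    using sum_geometric_le[OF assms(2,3)] sum_geometric_le[OF assms(4,5)] by simp
qed

lemma geometric_remove_first:
  assumes "x \<in> geometric c r" "x \<noteq> c"
  shows "x \<in> geometric (c * r) r"
proof -
  obtain k where k: "x = c * r ^ k" using assms(1) by (auto simp: geometric_def)
  then obtain j where "k = Suc j" using assms(2) by (cases k) auto
  then show ?thesis using k by (auto simp: geometric_def)
qed

text \<open>For even \<open>f1\<close>, no divisor of \<open>2 ^ f1 + 1\<close> is 3 modulo 4, so
  only 4 remains of the progression \<open>4 * 5 ^ b\<close>.\<close>

lemma factor_cases:
  assumes "x \<in> factors"
  shows "x \<in> geometric 10 5 \<or> x \<in> geometric 4 5 \<and> (odd f1 \<or> x = 4)
    \<or> x \<in> geometric 8 4 \<and> odd f2 \<and> f2 > 1"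
proof -
  obtain p where p: "p \<in> prime_factors N" "x = component p + 1"
    using assms by (auto simp: factors_def)
  show ?thesis
    using p(1)
  proof (cases rule: component_cases)
    case (one b)
    then show ?thesis using p(2) by (auto simp: geometric_def)
  next
    case (three b)
    have "p mod 4 = 3" using three(2) by presburger
    then have "odd f1 \<or> b = 0" using three(3) dvd_two_power_plus_1(2)[of p f1] by blast
    then show ?thesis using three(1) p(2) by (auto simp: geometric_def)
  next
    case (seven k)
    then show ?thesis using p(2) by (auto simp: geometric_def)
  qed
qed

section \<open>Bounds for the reciprocal sum by parity and size of the exponents\<close>

lemma sum_le_if_f1_eq_1:
  assumes "f1 = 1"
  shows "(\<Sum>x\<in>factors. 1 / real x) \<le> 1 / 8"
proof -
  have "x \<in> geometric 10 5" if x: "x \<in> factors" for x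
  proof -
    obtain p where "p \<in> prime_factors N" "x = component p + 1"
      using x by (auto simp: factors_def)
    then have "x dvd 2 ^ 1 * 5 ^ f2"
      using dvd_prodI[of "prime_factors N" p "\<lambda>p. component p + 1"]
      unfolding prod_factors assms by simp
    moreover have "\<not> 2 ^ 2 dvd (2 ^ 1 * 5 ^ f2 :: nat)" by (subst two_power_dvd_iff) auto
    ultimately have "\<not> 4 dvd x" using dvd_trans[of 4 x "2 * 5 ^ f2"] by auto
    then show ?thesis using factor_cases[OF x] by (auto simp: geometric_def)
  qed
  then have "factors \<subseteq> geometric 10 5" by blast
  then show ?thesis using sum_inverse_geometric_le[OF _ finite_factors, of 10 5]
    by (simp add: geometric_def)
qed

text \<open>The progression \<open>8 * 4 ^ k\<close> is absent, and 4 or 10 is missing. The worse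
  case lacks 10 and gives 1/40 + 5/16.\<close>

lemma sum_le_if_no_seven:
  assumes "even f2 \<or> f2 = 1"
  shows "(\<Sum>x\<in>factors. 1 / real x) \<le> 27 / 80"
proof -
  have cover: "x \<in> geometric 10 5 \<or> x \<in> geometric 4 5" if "x \<in> factors" for x
    using factor_cases[OF that] assms by auto
  show ?thesis
  proof (cases "component 3 = 9")
    case True
    then have "factors \<subseteq> geometric 10 5 \<union> geometric 20 5"
      using cover four_not_in_factors geometric_remove_first[of _ 4 5] by force
    from sum_cover2[OF this] show ?thesis by simp
  next
    case False
    then have "factors \<subseteq> geometric 50 5 \<union> geometric 4 5"
      using cover ten_not_in_factors geometric_remove_first[of _ 10 5] by force
    from sum_cover2[OF this] show ?thesis by simp
  qed
qed

text \<open>The worse case again lacks 10 and gives 1/40 + 1/6 + 1/4.\<close>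

lemma sum_le_if_even_f1:
  assumes "even f1"
  shows "(\<Sum>x\<in>factors. 1 / real x) \<le> 53 / 120"
proof -
  have cover: "x \<in> geometric 10 5 \<or> x \<in> geometric 8 4 \<or> x = 4" if "x \<in> factors" for x
    using factor_cases[OF that] assms by auto
  show ?thesis
  proof (cases "component 3 = 9")
    case True
    then have "factors \<subseteq> geometric 10 5 \<union> geometric 8 4"
      using cover four_not_in_factors by force
    from sum_cover2[OF this] show ?thesis by simp
  next
    case False
    then have "factors \<subseteq> geometric 50 5 \<union> geometric 8 4 \<union> {4}"
      using cover ten_not_in_factors geometric_remove_first[of _ 10 5] by force
    moreover have "(\<Sum>x\<in>factors \<inter> {4}. 1 / real x) \<le> 1 / 4"
      by (cases "4 \<in> factors") auto
    ultimately show ?thesis using sum_cover3[of 50 5 8 4 "{4}"] by simp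
  qed
qed

text \<open>Both factors of \<open>2 * N\<close> are divisible by 3, so 9 divides \<open>N\<close>
  and 4 drops out. What remains is 1/8 + 1/16 + 1/6.\<close>

lemma sum_le_if_odd:
  assumes "odd f1" "odd f2"
  shows "(\<Sum>x\<in>factors. 1 / real x) \<le> 17 / 48"
proof -
  have "3 dvd 2 ^ f1 + (1::nat)" "3 dvd 5 ^ f2 + (1::nat)"
    using assms three_dvd_odd_power_plus_1 by auto
  then have "3 * 3 dvd 2 * N" unfolding double by (rule mult_dvd_mono)
  moreover have "coprime (3 ^ 2) (2::nat)" by simp
  ultimately have "3 ^ 2 dvd N"
    by (simp add: power2_eq_square coprime_dvd_mult_right_iff del: mult_numeral_left_semiring_numeral)
  then have "multiplicity 3 N \<ge> 2" using N_pos by (intro multiplicity_geI) auto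
  then have "component 3 \<noteq> 3" using power_increasing[of 2 "multiplicity 3 N" "3::nat"]
    by (simp add: component_def)
  then have "4 \<notin> factors" by (rule four_not_in_factors)
  then have "factors \<subseteq> geometric 10 5 \<union> geometric 20 5 \<union> geometric 8 4"
    using factor_cases geometric_remove_first[of _ 4 5] by force
  from sum_cover3[OF this] sum_geometric_le[of 8 4] show ?thesis by simp
qed

section \<open>Case analysis on the exponents\<close>

lemma N_eq_9: "N = 9"
proof -
  define x y where "x = 1 / (2::real) ^ f1" and "y = 1 / (5::real) ^ f2"
  define D where "D = (\<Sum>x\<in>factors. 1 / real x)"
  have main: "1 - D \<le> (1 + x) * (1 + y) / 2"
    using one_minus_sum_factors_le by (simp add: D_def x_def y_def)
  have x_le: "x \<le> 1 / 2 ^ k" if "k \<le> f1" for k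
    using that by (simp add: x_def frac_le power_increasing)
  have y_le: "y \<le> 1 / 5 ^ k" if "k \<le> f2" for k
    using that by (simp add: y_def frac_le power_increasing)
  have bound: "1 - D \<le> (1 + u) * (1 + v) / 2" if "x \<le> u" "y \<le> v" for u v
  proof -
    have "0 \<le> x" "0 \<le> y" by (auto simp: x_def y_def)
    then have "(1 + x) * (1 + y) \<le> (1 + u) * (1 + v)" using that by (intro mult_mono) auto
    then show ?thesis using main by linarith
  qed
  consider "f1 = 1" "f2 = 1" | "f1 = 1" "f2 \<ge> 2" | "f1 = 2" "odd f2" | "f1 = 3" "f2 = 1"
    | "f1 \<ge> 4" "f2 = 1" | "f1 \<ge> 2" "even f2" "f2 \<ge> 2" | "f1 \<ge> 4" "even f1" "f2 \<ge> 3"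
    | "f1 \<ge> 3" "odd f1" "odd f2" "f2 \<ge> 3"
  proof -
    have "f1 = 1 \<or> f1 = 2 \<or> f1 = 3 \<or> f1 \<ge> 4" "f2 = 1 \<or> f2 = 2 \<or> f2 \<ge> 3"
      using f1_pos f2_pos by linarith+
    then show ?thesis using that by (elim disjE) auto
  qed
  then show ?thesis
  proof cases
    case 1
    then show ?thesis using double by simp
  next
    case 2
    then show ?thesis using bound[OF x_le[of 1] y_le[of 2]] sum_le_if_f1_eq_1 by (simp add: D_def)
  next
    \<comment> \<open>The estimates are too weak here, but \<open>2 ^ 2 + 1 = 5\<close> divides
      \<open>2 * N\<close>.\<close>
    case 3
    then have "5 dvd 2 * N" using double by simp
    then have "5 dvd N" by presburger
    then show ?thesis using not_5_dvd by blast
  next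
    case 4
    then have "N = 3 ^ 3" using double by simp
    then have "usigma N = 28" using usigma_prime_power[of 3 3] by simp
    then show ?thesis using usigma_N 4 by simp
  next
    case 5
    then show ?thesis using bound[OF x_le[of 4] y_le[of 1]] sum_le_if_no_seven by (simp add: D_def)
  next
    \<comment> \<open>The tightest comparison: 1 - 27/80 = 0.6625 against (5/4) * (26/25) / 2 =
      0.65.\<close>
    case 6
    then show ?thesis using bound[OF x_le[of 2] y_le[of 2]] sum_le_if_no_seven by (simp add: D_def)
  next
    case 7
    then show ?thesis using bound[OF x_le[of 4] y_le[of 3]] sum_le_if_even_f1 by (simp add: D_def)
  next
    case 8
    then show ?thesis using bound[OF x_le[of 3] y_le[of 3]] sum_le_if_odd by (simp add: D_def)
  qed
qed

end

theorem theorem5p3: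
  fixes N q f1 f2 :: nat
  assumes "N > 0" and "odd N"
    and "usigma (usigma N) = 2 * N"
    and "N \<noteq> 9" and "N \<noteq> 165"
    and "prime q" and "odd q"
    and "f1 \<ge> 1" and "f2 \<ge> 1"
    and "usigma N = 2 ^ f1 * q ^ f2"
  shows "q \<noteq> 5"
proof
  assume "q = 5"
  \<comment> \<open>Evaluating the outer \<open>usigma\<close> turns the hypothesis on
    \<open>usigma (usigma N)\<close> into \<open>double\<close>.\<close>
  have "usigma (2 ^ f1 * 5 ^ f2) = usigma (2 ^ f1) * usigma (5 ^ f2)"
    by (rule usigma_mult) auto
  also have "\<dots> = (2 ^ f1 + 1) * (5 ^ f2 + 1)"
    using assms(8,9) by (simp add: usigma_prime_power)
  finally interpret unitary_superperfect_five N f1 f2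
    using assms \<open>q = 5\<close> by unfold_locales auto
  show False using N_eq_9 assms(4) by blast
qed

end
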